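(* Let $R$ be a unique factorization domain with quotient field $Q(R)$, let $f(s)=\frac{a_m}{m^s}+\cdots+\frac{a_n}{n^s}$ be an algebraically primitive Dirichlet polynomial with coefficients in $R$, $a_ma_n\neq0$, let $p$ be a prime element of $R$, and let $q_1,\dots,q_k$ be all the prime factors of $m\cdot n$. If (i) $\nu_p(a_n)\neq\nu_p(a_m)$, (ii) $\left(\frac{n}{i}\right)^{\nu_p(a_i)-\nu_p(a_m)}>\left(\frac{m}{i}\right)^{\nu_p(a_i)-\nu_p(a_n)}$ for $m<i<n$, (iii) $\gcd(\nu_p(a_n)-\nu_p(a_m),\ \nu_{q_1}(n)-\nu_{q_1}(m),\dots,\nu_{q_k}(n)-\nu_{q_k}(m))=1$, then $f$ is irreducible over $Q(R)$.
   Context: Dirichlet polynomials $\sum_i \frac{a_i}{i^s}$ are multiplied by the Dirichlet product $\left(\sum_j\frac{b_j}{j^s}\right)\left(\sum_k\frac{c_k}{k^s}\right)=\sum_i\frac{\sum_{jk=i}b_jc_k}{i^s}$; constant means supported on $\{1\}$; algebraically primitive means the indices $i$ with $a_i\neq0$ have gcd $1$. $\nu_p$ is the $p$-adic valuation, with $\nu_p(0)=+\infty$ (so condition (ii) only concerns $i$ with $a_i\ne 0$). Irreducible over $Q(R)$: not a product of two nonconstant Dirichlet polynomials with coefficients in $Q(R)$. *)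

theory Defs
  imports Complex_Main "HOL-Computational_Algebra.Computational_Algebra"
begin

text \<open>
  A Dirichlet polynomial \<open>\<Sum>i. a i / i\<^sup>s\<close> is represented by its coefficient function.
  The indices are the positive integers, so the junk index \<open>0\<close> must carry coefficient \<open>0\<close>.
\<close>

definition dirichlet_poly :: "(nat \<Rightarrow> 'a::zero) \<Rightarrow> bool" where
  "dirichlet_poly a \<longleftrightarrow> a 0 = 0 \<and> finite {i. a i \<noteq> 0}"

text \<open>
  For \<open>i > 0\<close> the index set of the sum is finite; for \<open>i = 0\<close> it is infinite, so the sum would
  be \<open>0\<close> by convention, which is made explicit here.
\<close>

definition dirichlet_prod ::
    "(nat \<Rightarrow> 'a::comm_semiring_0) \<Rightarrow> (nat \<Rightarrow> 'a) \<Rightarrow> nat \<Rightarrow> 'a" where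
  "dirichlet_prod b c i = (if i = 0 then 0 else (\<Sum>(j, k)\<in>{(j, k). j * k = i}. b j * c k))"

definition dirichlet_const :: "(nat \<Rightarrow> 'a::zero) \<Rightarrow> bool" where
  "dirichlet_const a \<longleftrightarrow> {i. a i \<noteq> 0} \<subseteq> {1}"

definition algebraically_primitive :: "(nat \<Rightarrow> 'a::zero) \<Rightarrow> bool" where
  "algebraically_primitive a \<longleftrightarrow> Gcd {i. a i \<noteq> 0} = 1"

definition dirichlet_irreducible :: "(nat \<Rightarrow> 'k::field) \<Rightarrow> bool" where
  "dirichlet_irreducible f \<longleftrightarrow>
     \<not> (\<exists>g h. dirichlet_poly g \<and> dirichlet_poly h \<and>
            \<not> dirichlet_const g \<and> \<not> dirichlet_const h \<and> f = dirichlet_prod g h)"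

text \<open>
  The \<open>p\<close>-adic valuation of a nonzero element, as an integer so that differences do not truncate.
  The library's \<^const>\<open>multiplicity\<close> is \<open>0\<close> at \<open>0\<close>, not \<open>\<infinity>\<close>:
  uses of \<open>val p x\<close> must be restricted to \<open>x \<noteq> 0\<close>.
\<close>

definition val :: "'a::factorial_semiring \<Rightarrow> 'a \<Rightarrow> int" where
  "val p x = int (multiplicity p x)"

end

theory Submission
  imports Defs
begin

text \<open>
  In the plane of the points \<open>(ln i, \<nu>\<^sub>p (a i))\<close>, condition (ii) says that every point with \<open>m < i < n\<close>
  lies strictly above the segment joining the two extreme points. Clear denominators in a
  factorization, so that a multiple of \<open>f\<close> is \<open>g h\<close> over \<open>R\<close>. As for Newton polygons, the face of \<open>g h\<close>
  in the direction of that segment is the sum of the faces of \<open>g\<close> and \<open>h\<close>; if these run over indices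
  from \<open>j\<close> to \<open>j'\<close> and from \<open>k\<close> to \<open>k'\<close>, then \<open>m = j k\<close> and \<open>n = j' k'\<close>, and both faces are parallel to the
  segment. By unique factorization the ratio of lengths is the same for the exponent vectors of
  \<open>j' / j\<close> and \<open>n / m\<close>, so by (iii) it is an integer, hence \<open>0\<close> or \<open>1\<close>, and one factor has a face that is
  a single point. This factor is then a single term \<open>c / j\<^sup>s\<close>, and \<open>j\<close> divides all indices of \<open>f\<close>, so \<open>j = 1\<close>.
\<close>

section \<open>Valuations of sums\<close>

text \<open>Otherwise every term, zero terms included, would be divisible by one more power of
  \<open>p\<close> than the sum is.\<close>

lemma sum_multiplicity_ge:
  fixes f :: "'b \<Rightarrow> 'a::{factorial_semiring, idom}"
  assumes "prime_elem p" "finite A" "sum f A \<noteq> 0"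
  obtains x where "x \<in> A" "f x \<noteq> 0" "multiplicity p (f x) \<le> multiplicity p (sum f A)"
proof -
  let ?e = "multiplicity p (sum f A)"
  have unit: "\<not> is_unit p"
    using assms(1) by (auto simp: prime_elem_def)
  have "\<exists>x\<in>A. f x \<noteq> 0 \<and> multiplicity p (f x) \<le> ?e"
  proof (rule ccontr)
    assume "\<not> ?thesis"
    then have "p ^ Suc ?e dvd f x" if "x \<in> A" for x
      using that by (cases "f x = 0") (auto intro!: multiplicity_dvd' simp del: power_Suc)
    then have "p ^ Suc ?e dvd sum f A"
      by (rule dvd_sum)
    then show False
      using power_dvd_iff_le_multiplicity[OF assms(3) unit] by (metis Suc_n_not_le_n)
  qed
  then show thesis
    using that by blast
qed

text \<open>Modulo \<open>p ^ Suc e\<close>, with \<open>e\<close> the multiplicity of the term at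
  \<open>x\<close>, only that term survives, so no cancellation can raise the multiplicity.\<close>

lemma sum_multiplicity_eq:
  fixes f :: "'b \<Rightarrow> 'a::{factorial_semiring, idom}"
  assumes "prime_elem p" "finite A" "x \<in> A" "f x \<noteq> 0"
    and less: "\<And>y. y \<in> A - {x} \<Longrightarrow> f y \<noteq> 0 \<Longrightarrow> multiplicity p (f x) < multiplicity p (f y)"
  shows "sum f A \<noteq> 0" "multiplicity p (sum f A) = multiplicity p (f x)"
proof -
  let ?e = "multiplicity p (f x)"
  have unit: "\<not> is_unit p"
    using assms(1) by (auto simp: prime_elem_def)
  have "p ^ Suc ?e dvd f y" if "y \<in> A - {x}" for y
    using less[OF that] by (cases "f y = 0") (auto intro!: multiplicity_dvd' simp del: power_Suc)
  then have rest: "p ^ Suc ?e dvd sum f (A - {x})"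
    by (rule dvd_sum)
  have split: "sum f A = f x + sum f (A - {x})"
    using assms by (simp add: sum.remove)
  have "\<not> p ^ Suc ?e dvd f x"
    using power_dvd_iff_le_multiplicity[OF assms(4) unit] by (metis Suc_n_not_le_n)
  then have nd: "\<not> p ^ Suc ?e dvd sum f A"
    using rest unfolding split by (metis dvd_add_left_iff)
  then show "sum f A \<noteq> 0"
    by auto
  have "p ^ ?e dvd sum f A"
    unfolding split
    by (intro dvd_add multiplicity_dvd dvd_trans[OF _ rest]) (simp add: le_imp_power_dvd)
  then show "multiplicity p (sum f A) = ?e"
    using nd by (intro multiplicity_eqI)
qed

lemma val_mult:
  fixes x y :: "'a::{factorial_semiring, idom}"
  assumes "prime_elem p" "x \<noteq> 0" "y \<noteq> 0"
  shows "val p (x * y) = val p x + val p y"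
  using assms by (simp add: val_def prime_elem_multiplicity_mult_distrib)

text \<open>Exponentiation turns the relation into an equation between natural numbers, in which the
  multiplicities of \<open>q\<close> can be compared. Parallel segments on the logarithmic scale
  thus have proportional exponent vectors.\<close>

lemma val_proportional_ln:
  fixes a b c d q :: nat and s t :: int
  assumes "prime q" "0 < a" "0 < b" "0 < c" "0 < d"
    and "s * (ln a - ln b) = t * (ln c - ln d)"
  shows "s * (val q a - val q b) = t * (val q c - val q d)"
proof -
  have nonneg: "int s * (val q a - val q b) = int t * (val q c - val q d)"
    if pos: "0 < a" "0 < b" "0 < c" "0 < d"
      and eq: "real s * (ln a - ln b) = real t * (ln c - ln d)" for a b c d s t :: nat
  proof -
    have "ln (real (a ^ s * d ^ t)) = ln (real (c ^ t * b ^ s))"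
      using pos eq by (simp add: ln_mult ln_realpow algebra_simps)
    then have "real (a ^ s * d ^ t) = real (c ^ t * b ^ s)"
      using pos by (subst (asm) ln_inj_iff) auto
    then have "multiplicity q (a ^ s * d ^ t) = multiplicity q (c ^ t * b ^ s)"
      using of_nat_eq_iff by metis
    then have "s * multiplicity q a + t * multiplicity q d
        = t * multiplicity q c + s * multiplicity q b"
      using pos \<open>prime q\<close>
      by (simp add: prime_elem_multiplicity_mult_distrib prime_elem_multiplicity_power_distrib)
    then have "int (s * multiplicity q a + t * multiplicity q d)
        = int (t * multiplicity q c + s * multiplicity q b)"
      by (rule arg_cong)
    then show ?thesis
      by (simp add: val_def algebra_simps)
  qed
  \<comment> \<open>A negative coefficient becomes positive when the two arguments of its difference
    are exchanged.\<close>
  consider "0 \<le> s" "0 \<le> t" | "0 \<le> s" "t < 0" | "s < 0" "0 \<le> t" | "s < 0" "t < 0"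
    by linarith
  then show ?thesis
  proof cases
    case 1
    then show ?thesis using nonneg[of a b c d "nat s" "nat t"] assms by simp
  next
    case 2
    then show ?thesis using nonneg[of a b d c "nat s" "nat (-t)"] assms
      by (simp add: algebra_simps)
  next
    case 3
    then show ?thesis using nonneg[of b a c d "nat (-s)" "nat t"] assms
      by (simp add: algebra_simps)
  next
    case 4
    then show ?thesis using nonneg[of b a d c "nat (-s)" "nat (-t)"] assms
      by (simp add: algebra_simps)
  qed
qed

section \<open>Weights of Dirichlet products\<close>

text \<open>
  Up to normalization, the level sets of the weight are the lines of slope \<open>D / L\<close> in the plane of
  the points \<open>(ln i, \<nu>\<^sub>p (x i))\<close>, so the indices of minimal weight form an edge of the Newton polygon.
\<close>

definition weight :: "real \<Rightarrow> real \<Rightarrow> 'a::factorial_semiring \<Rightarrow> (nat \<Rightarrow> 'a) \<Rightarrow> nat \<Rightarrow> real" where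
  "weight L D p x i = L * real_of_int (val p (x i)) - D * ln (real i)"

lemma finite_mult_eq: "0 < i \<Longrightarrow> finite {(j, k). j * k = (i::nat)}"
  by (rule finite_subset[of _ "{..i} \<times> {..i}"]) auto

text \<open>Weights add on products of terms, since \<open>ln\<close> and \<open>val p\<close> are
  both additive, so a summand whose valuation is at most that of the sum will do.\<close>

lemma dirichlet_prod_weight_ge:
  fixes g h :: "nat \<Rightarrow> 'a::{factorial_semiring, idom}"
  assumes "prime_elem p" "0 < L" "dirichlet_prod g h i \<noteq> 0"
  obtains j k where "j * k = i" "g j \<noteq> 0" "h k \<noteq> 0"
    "weight L D p g j + weight L D p h k \<le> weight L D p (dirichlet_prod g h) i"
proof -
  have i: "0 < i" and prod: "dirichlet_prod g h i = (\<Sum>(j, k)\<in>{(j, k). j * k = i}. g j * h k)"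
    using assms(3) by (auto simp: dirichlet_prod_def split: if_splits)
  obtain y where "y \<in> {(j, k). j * k = i}" "(case y of (j, k) \<Rightarrow> g j * h k) \<noteq> 0"
      "multiplicity p (case y of (j, k) \<Rightarrow> g j * h k) \<le> multiplicity p (dirichlet_prod g h i)"
    by (rule sum_multiplicity_ge[OF assms(1) finite_mult_eq[OF i] assms(3)[unfolded prod],
          folded prod])
  then obtain j k where jk: "j * k = i" "g j * h k \<noteq> 0"
      and le: "multiplicity p (g j * h k) \<le> multiplicity p (dirichlet_prod g h i)"
    by (cases y) simp
  have "val p (g j) + val p (h k) \<le> val p (dirichlet_prod g h i)"
    using le jk assms(1) by (simp add: val_def prime_elem_multiplicity_mult_distrib)
  then have "L * (val p (g j) + val p (h k)) \<le> L * val p (dirichlet_prod g h i)"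
    using assms(2) by (metis mult_left_mono less_imp_le of_int_le_iff)
  moreover have "ln (real i) = ln (real j) + ln (real k)"
    using jk(1) i by (auto simp: ln_mult)
  ultimately show thesis
    using jk that[of j k] by (simp add: weight_def algebra_simps)
qed

text \<open>All pairs contributing to one coefficient have the same sum of logarithms. As
  \<open>L\<close> is positive, their weights are ordered like their valuations, and a strict
  minimum cannot cancel.\<close>

lemma dirichlet_prod_weight_eq:
  fixes g h :: "nat \<Rightarrow> 'a::{factorial_semiring, idom}"
  assumes "prime_elem p" "0 < L" "0 < j" "0 < k" "g j \<noteq> 0" "h k \<noteq> 0"
    and less: "\<And>j' k'. j' * k' = j * k \<Longrightarrow> (j', k') \<noteq> (j, k) \<Longrightarrow> g j' \<noteq> 0 \<Longrightarrow> h k' \<noteq> 0 \<Longrightarrow>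
      weight L D p g j + weight L D p h k < weight L D p g j' + weight L D p h k'"
  shows "dirichlet_prod g h (j * k) \<noteq> 0"
    "weight L D p (dirichlet_prod g h) (j * k) = weight L D p g j + weight L D p h k"
proof -
  let ?A = "{(j', k'). j' * k' = j * k}"
  have prod: "dirichlet_prod g h (j * k) = (\<Sum>(j, k)\<in>?A. g j * h k)"
    using assms by (simp add: dirichlet_prod_def)
  have fin: "finite ?A"
    using assms by (intro finite_mult_eq) auto
  have "multiplicity p (g j * h k) < multiplicity p (g j' * h k')"
    if "j' * k' = j * k" "(j', k') \<noteq> (j, k)" "g j' * h k' \<noteq> 0" for j' k'
  proof -
    have nz: "g j' \<noteq> 0" "h k' \<noteq> 0" "0 < j'" "0 < k'"
      using that assms(3,4) by (auto intro!: gr0I)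
    have "ln (real j') + ln (real k') = ln (real j) + ln (real k)"
      using arg_cong[OF that(1), of "\<lambda>i. ln (real i)"] nz assms(3,4) by (simp add: ln_mult)
    then have "D * ln (real j') + D * ln (real k') = D * ln (real j) + D * ln (real k)"
      by (metis distrib_left)
    then have "L * (val p (g j) + val p (h k)) < L * (val p (g j') + val p (h k'))"
      using less[OF that(1,2) nz(1,2)] by (simp add: weight_def algebra_simps)
    then have "val p (g j) + val p (h k) < val p (g j') + val p (h k')"
      using assms(2) by (metis mult_less_cancel_left_pos of_int_less_iff)
    then show ?thesis
      using nz assms by (simp add: val_def prime_elem_multiplicity_mult_distrib)
  qed
  then have *: "multiplicity p (case (j, k) of (j, k) \<Rightarrow> g j * h k)
      < multiplicity p (case y of (j, k) \<Rightarrow> g j * h k)"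
    if "y \<in> ?A - {(j, k)}" "(case y of (j, k) \<Rightarrow> g j * h k) \<noteq> 0" for y
    using that by (cases y) auto
  have "(j, k) \<in> ?A" "(case (j, k) of (j, k) \<Rightarrow> g j * h k) \<noteq> 0"
    using assms by auto
  note s = sum_multiplicity_eq[where f = "\<lambda>(j, k). g j * h k", OF assms(1) fin this *]
  show "dirichlet_prod g h (j * k) \<noteq> 0"
    using s(1) unfolding prod by simp
  have "val p (dirichlet_prod g h (j * k)) = val p (g j) + val p (h k)"
    using s(2) assms unfolding prod by (simp add: val_def prime_elem_multiplicity_mult_distrib)
  then show "weight L D p (dirichlet_prod g h) (j * k) = weight L D p g j + weight L D p h k"
    using assms by (simp add: weight_def ln_mult algebra_simps)
qed

section \<open>Supports of Dirichlet products\<close>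

lemma dirichlet_prod_unique_term:
  assumes "0 < j" "0 < k"
    and "\<And>j' k'. j' * k' = j * k \<Longrightarrow> g j' \<noteq> 0 \<Longrightarrow> h k' \<noteq> 0 \<Longrightarrow> (j', k') = (j, k)"
  shows "dirichlet_prod g h (j * k) = (g j * h k :: 'a::idom)"
proof -
  let ?A = "{(j', k'). j' * k' = j * k}"
  have "dirichlet_prod g h (j * k) = (\<Sum>(j, k)\<in>?A. g j * h k)"
    using assms by (simp add: dirichlet_prod_def)
  also have "\<dots> = (\<Sum>(j, k)\<in>{(j, k)}. g j * h k)"
    using assms by (intro sum.mono_neutral_right finite_mult_eq) auto
  finally show ?thesis
    by simp
qed

lemma dirichlet_prod_commute: "dirichlet_prod g h = dirichlet_prod h g"
proof
  fix i
  have "(\<Sum>(j, k)\<in>{(j, k). j * k = i}. g j * h k) = (\<Sum>(j, k)\<in>{(j, k). j * k = i}. h j * g k)"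
    by (rule sum.reindex_bij_witness[of _ prod.swap prod.swap]) (auto simp: mult.commute)
  then show "dirichlet_prod g h i = dirichlet_prod h g i"
    by (simp add: dirichlet_prod_def)
qed

lemma dirichlet_prod_nonzeroE:
  assumes "dirichlet_prod g h i \<noteq> 0"
  obtains j k where "j * k = i" "g j \<noteq> 0" "h k \<noteq> 0"
proof -
  have "(\<Sum>(j, k)\<in>{(j, k). j * k = i}. g j * h k) \<noteq> 0"
    using assms by (auto simp: dirichlet_prod_def split: if_splits)
  then obtain y where "y \<in> {(j, k). j * k = i}" "(case y of (j, k) \<Rightarrow> g j * h k) \<noteq> 0"
    by (rule sum.not_neutral_contains_not_neutral)
  then show thesis
    using that by (cases y) (auto, metis mult_zero_left mult_zero_right)
qed

text \<open>Every index in the support of the product is a multiple of \<open>j\<close>, so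
  primitivity forces \<open>j = 1\<close>.\<close>

lemma dirichlet_const_if_singleton_support:
  assumes "algebraically_primitive (dirichlet_prod g h)" "\<And>i. g i \<noteq> 0 \<Longrightarrow> i = j"
  shows "dirichlet_const g"
proof -
  have "j dvd i" if "dirichlet_prod g h i \<noteq> 0" for i
    using that assms(2) by (metis dirichlet_prod_nonzeroE dvd_triv_left)
  then have "j dvd Gcd {i. dirichlet_prod g h i \<noteq> 0}"
    by (intro Gcd_greatest) auto
  then have "j = 1"
    using assms(1) by (simp add: algebraically_primitive_def)
  then show ?thesis
    using assms(2) by (auto simp: dirichlet_const_def)
qed

section \<open>Faces of minimal weight and primitive edges\<close>

lemma minimizers_extremes:
  fixes w :: "nat \<Rightarrow> real"
  assumes "finite A" "A \<noteq> {}"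
  obtains j j' where "j \<in> A" "j' \<in> A" "w j' = w j"
    "\<And>i. i \<in> A \<Longrightarrow> w j \<le> w i" "\<And>i. i \<in> A \<Longrightarrow> w i = w j \<Longrightarrow> j \<le> i \<and> i \<le> j'"
proof -
  define S where "S = {i \<in> A. w i = Min (w ` A)}"
  have "Min (w ` A) \<in> w ` A"
    using assms by (intro Min_in) auto
  then have S: "finite S" "S \<noteq> {}"
    using assms(1) by (auto simp: S_def)
  have "Min S \<in> S" "Max S \<in> S"
    using S by (auto intro: Min_in Max_in)
  then have "Min S \<in> A" "Max S \<in> A" "w (Min S) = Min (w ` A)" "w (Max S) = Min (w ` A)"
    by (auto simp: S_def)
  moreover have "Min S \<le> i \<and> i \<le> Max S" if "i \<in> A" "w i = Min (w ` A)" for i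
    using that S by (auto simp: S_def)
  ultimately show thesis
    using that[of "Min S" "Max S"] assms(1) by auto
qed

text \<open>
  A lattice vector proportional to a primitive one is an integer multiple of it; here the ratio lies
  in \<open>[0, 1]\<close>, so one of the two summands vanishes.
\<close>

lemma primitive_edge_indecomposable:
  fixes d D :: int and j j' k k' :: nat
  assumes "0 < j" "0 < k" "j \<le> j'" "k \<le> k'" "j * k < j' * k'" "D \<noteq> 0"
    and slope: "d * (ln (j' * k') - ln (j * k)) = D * (ln j' - ln j)"
    and gcd: "Gcd (insert D ((\<lambda>q. val q (j' * k') - val q (j * k)) ` Q)) = 1"
    and Q: "\<And>q. q \<in> Q \<Longrightarrow> prime q"
  shows "j = j' \<or> k = k'"
proof -
  define L where "L = ln (real j') + ln (real k') - ln (real j) - ln (real k)"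
  have L: "ln (real (j' * k')) - ln (real (j * k)) = L"
    using assms by (simp add: L_def ln_mult)
  have "ln (real (j * k)) < ln (real (j' * k'))"
    using assms by (subst ln_less_cancel_iff) (simp_all flip: of_nat_mult)
  then have "0 < L"
    using L by simp
  let ?V = "insert D ((\<lambda>q. val q (j' * k') - val q (j * k)) ` Q)"
  \<comment> \<open>Proportionality passes from logarithms to each prime exponent. So
    \<open>D\<close> divides \<open>d\<close> times every entry of a vector with gcd 1, and hence
    \<open>d\<close> itself.\<close>
  have "D dvd d * v" if v: "v \<in> ?V" for v
  proof (cases "v = D")
    case False
    then obtain q where q: "q \<in> Q" "v = val q (j' * k') - val q (j * k)"
      using v by auto
    have "d * (val q (j' * k') - val q (j * k)) = D * (val q j' - val q j)"
      using assms q by (intro val_proportional_ln) auto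
    then show ?thesis
      using q by simp
  qed simp
  then have "D dvd Gcd ((*) d ` ?V)"
    by (intro Gcd_greatest) auto
  then have "D dvd d"
    using gcd by (simp only: Gcd_mult) simp
  then obtain e where e: "d = D * e"
    by (auto simp: dvd_def)
  have "D * (e * L) = D * (ln (real j') - ln (real j))"
    using slope unfolding L e by (simp add: mult.assoc)
  then have eL: "e * L = ln (real j') - ln (real j)"
    using \<open>D \<noteq> 0\<close> by simp
  \<comment> \<open>The total length \<open>L\<close> is the sum of two nonnegative lengths, one of
    which is \<open>e * L\<close>; this confines the integer \<open>e\<close> to 0 and 1.\<close>
  have "ln (real j) \<le> ln (real j')" "ln (real k) \<le> ln (real k')"
    using assms by auto
  then have "0 \<le> e * L" "e * L \<le> 1 * L"
    unfolding eL by (auto simp: L_def)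
  then have "0 \<le> e" "e \<le> 1"
    using \<open>0 < L\<close> by (simp_all add: zero_le_mult_iff)
  then consider "e = 0" | "e = 1"
    by linarith
  then show ?thesis
  proof cases
    case 1
    then show ?thesis using eL assms by simp
  next
    case 2
    then have "ln (real k') = ln (real k)"
      using eL by (simp add: L_def)
    then show ?thesis using assms by simp
  qed
qed

text \<open>By \<open>above\<close>, only \<open>m\<close> and \<open>n\<close> can attain the least
  weight of \<open>a\<close>. The faces of \<open>g\<close> and \<open>h\<close> therefore add up to
  one primitive edge, and one of them is a point.\<close>

lemma newton_edge_const_factor:
  fixes g h :: "nat \<Rightarrow> 'a::{factorial_semiring, idom}"
  defines "a \<equiv> dirichlet_prod g h"
  assumes g: "dirichlet_poly g" and h: "dirichlet_poly h"
    and range: "\<And>i. a i \<noteq> 0 \<Longrightarrow> m \<le> i \<and> i \<le> n"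
    and am: "a m \<noteq> 0" and an: "a n \<noteq> 0" and "m < n"
    and prim: "algebraically_primitive a" and p: "prime_elem p"
    and D: "D = val p (a n) - val p (a m)" "D \<noteq> 0"
    and L: "L = ln (real n) - ln (real m)"
    and above: "\<And>i. m < i \<Longrightarrow> i < n \<Longrightarrow> a i \<noteq> 0 \<Longrightarrow> weight L D p a m < weight L D p a i"
    and gcd: "Gcd (insert D ((\<lambda>q. val q n - val q m) ` prime_factors (m * n))) = 1"
  shows "dirichlet_const g \<or> dirichlet_const h"
proof -
  let ?G = "{i. g i \<noteq> 0}" and ?H = "{i. h i \<noteq> 0}"
  let ?wg = "weight L D p g" and ?wh = "weight L D p h" and ?wa = "weight L D p a"
  have fin: "finite ?G" "finite ?H" and zero: "g 0 = 0" "h 0 = 0"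
    using g h by (auto simp: dirichlet_poly_def)
  have pos: "0 < i" if "g i \<noteq> 0 \<or> h i \<noteq> 0" for i
    using that zero by (auto intro: gr0I)
  have ne: "?G \<noteq> {}" "?H \<noteq> {}"
    using am unfolding a_def by (auto elim: dirichlet_prod_nonzeroE)
  have "0 < m"
    using am by (auto simp: a_def dirichlet_prod_def split: if_splits)
  then have "0 < L"
    using \<open>m < n\<close> by (simp add: L)
  \<comment> \<open>The weight is built from \<open>D\<close> and \<open>L\<close> so that the
    segment between the two extreme points is level.\<close>
  have wmn: "?wa m = ?wa n"
    by (simp add: weight_def D L algebra_simps)
  obtain j j' where j: "g j \<noteq> 0" "g j' \<noteq> 0" "?wg j' = ?wg j"
      "\<And>i. g i \<noteq> 0 \<Longrightarrow> ?wg j \<le> ?wg i"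
      "\<And>i. g i \<noteq> 0 \<Longrightarrow> ?wg i = ?wg j \<Longrightarrow> j \<le> i \<and> i \<le> j'"
    using minimizers_extremes[OF fin(1) ne(1), of ?wg] by auto
  obtain k k' where k: "h k \<noteq> 0" "h k' \<noteq> 0" "?wh k' = ?wh k"
      "\<And>i. h i \<noteq> 0 \<Longrightarrow> ?wh k \<le> ?wh i"
      "\<And>i. h i \<noteq> 0 \<Longrightarrow> ?wh i = ?wh k \<Longrightarrow> k \<le> i \<and> i \<le> k'"
    using minimizers_extremes[OF fin(2) ne(2), of ?wh] by auto
  have jk: "j \<le> j'" "k \<le> k'" "0 < j" "0 < k" "0 < j'" "0 < k'"
    using j k pos by auto
  let ?\<mu> = "?wg j + ?wh k"
  \<comment> \<open>A pair of minimal weight has \<open>j \<le> u \<le> j'\<close> and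
    \<open>k \<le> v \<le> k'\<close>, so it reaches the product at either end only at that end.
    This rules out cancellation at both ends.\<close>
  have rigid: "(u, v) = (s, t)"
    if uv: "g u \<noteq> 0" "h v \<noteq> 0" "?wg u + ?wh v \<le> ?\<mu>" "u * v = s * t"
      and st: "(s, t) = (j, k) \<or> (s, t) = (j', k')" for u v s t
  proof -
    have "?wg u = ?wg j" "?wh v = ?wh k"
      using uv j(4)[of u] k(4)[of v] by linarith+
    then have bounds: "j \<le> u" "u \<le> j'" "k \<le> v" "v \<le> k'"
      using j(5) k(5) uv by auto
    have "0 < u" "0 < v"
      using uv pos by auto
    show ?thesis
      using st
    proof
      assume "(s, t) = (j, k)"
      then show ?thesis
        using mult_le_less_imp_less[of j u k v] mult_less_le_imp_less[of j u k v] bounds uv(4) jk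
        by (auto simp: le_less)
    next
      assume "(s, t) = (j', k')"
      then show ?thesis
        using mult_le_less_imp_less[of u j' v k'] mult_less_le_imp_less[of u j' v k'] bounds uv(4)
          \<open>0 < u\<close> \<open>0 < v\<close> by (auto simp: le_less)
    qed
  qed
  have ajk: "a (j * k) \<noteq> 0" "?wa (j * k) = ?\<mu>"
    unfolding a_def
    using dirichlet_prod_weight_eq[of p L j k g h D] rigid[where s = j and t = k] p \<open>0 < L\<close> jk j k
    by (meson not_le)+
  have ajk': "a (j' * k') \<noteq> 0" "?wa (j' * k') = ?\<mu>"
    unfolding a_def
    using dirichlet_prod_weight_eq[of p L j' k' g h D] rigid[where s = j' and t = k'] p \<open>0 < L\<close> jk j k
    unfolding j(3) k(3) by (meson not_le)+
  have lower: "?\<mu> \<le> ?wa i" if "a i \<noteq> 0" for i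
    using that dirichlet_prod_weight_ge[OF p \<open>0 < L\<close>, of g h i D] j(4) k(4)
    unfolding a_def by (smt (verit))
  \<comment> \<open>For \<open>m < i < n\<close>, \<open>above\<close> would put the weight at
    \<open>m\<close> below the lower bound \<open>?\<mu>\<close>.\<close>
  have corner: "i = m \<or> i = n" if "a i \<noteq> 0" "?wa i = ?\<mu>" for i
    using that above[of i] lower[OF am] range[of i] by fastforce
  have \<mu>: "?wa m = ?\<mu>" "?wa n = ?\<mu>"
    using corner[OF ajk] ajk wmn by auto
  \<comment> \<open>Some pair of terms at \<open>i\<close> has total weight at most
    \<open>?\<mu>\<close>, so both terms lie on the faces.\<close>
  have between: "j * k \<le> i \<and> i \<le> j' * k'" if i: "a i \<noteq> 0" "?wa i = ?\<mu>" for i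
  proof -
    obtain u v where uv: "u * v = i" "g u \<noteq> 0" "h v \<noteq> 0" "?wg u + ?wh v \<le> ?\<mu>"
      using dirichlet_prod_weight_ge[OF p \<open>0 < L\<close> i(1)[unfolded a_def], of D]
        i(2)[unfolded a_def] by metis
    then have "?wg u = ?wg j" "?wh v = ?wh k"
      using j(4)[of u] k(4)[of v] by linarith+
    then show ?thesis
      using j(5)[of u] k(5)[of v] uv by (auto intro!: mult_le_mono)
  qed
  have m: "m = j * k"
    using between[OF am \<mu>(1)] range[OF ajk(1)] by simp
  have n: "n = j' * k'"
    using between[OF an \<mu>(2)] range[OF ajk'(1)] by simp

  \<comment> \<open>Whatever their weights, the products of the two least and of the two greatest
    indices cannot cancel. Comparison with \<open>m = j * k\<close> and \<open>n = j' * k'\<close>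
    shows that the faces reach both ends of the supports, so a factor whose face is a point is a
    single term.\<close>
  have Gb: "Min ?G \<in> ?G" "Max ?G \<in> ?G" "\<And>i. g i \<noteq> 0 \<Longrightarrow> Min ?G \<le> i \<and> i \<le> Max ?G"
    using fin ne Min_in[of ?G] Max_in[of ?G] by auto
  have Hb: "Min ?H \<in> ?H" "Max ?H \<in> ?H" "\<And>i. h i \<noteq> 0 \<Longrightarrow> Min ?H \<le> i \<and> i \<le> Max ?H"
    using fin ne Min_in[of ?H] Max_in[of ?H] by auto
  have Gp: "0 < Min ?G" "0 < Max ?G" and Hp: "0 < Min ?H" "0 < Max ?H"
    using Gb Hb pos by blast+
  have "(u, v) = (Min ?G, Min ?H)"
    if "u * v = Min ?G * Min ?H" "g u \<noteq> 0" "h v \<noteq> 0" for u v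
    using that Gb(3)[of u] Hb(3)[of v] Gp Hp mult_le_less_imp_less[of "Min ?G" u "Min ?H" v]
      mult_less_le_imp_less[of "Min ?G" u "Min ?H" v] by (auto simp: le_less)
  then have "a (Min ?G * Min ?H) = g (Min ?G) * h (Min ?H)"
    unfolding a_def using Gp Hp by (intro dirichlet_prod_unique_term) auto
  then have "m \<le> Min ?G * Min ?H"
    using Gb(1) Hb(1) range[of "Min ?G * Min ?H"] by simp
  then have mins: "j = Min ?G" "k = Min ?H"
    using Gb(3)[OF j(1)] Hb(3)[OF k(1)] Gp Hp m mult_le_less_imp_less[of "Min ?G" j "Min ?H" k]
      mult_less_le_imp_less[of "Min ?G" j "Min ?H" k] by (auto simp: le_less)
  have "(u, v) = (Max ?G, Max ?H)"
    if "u * v = Max ?G * Max ?H" "g u \<noteq> 0" "h v \<noteq> 0" for u v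
    using that Gb(3)[of u] Hb(3)[of v] pos[of u] pos[of v]
      mult_le_less_imp_less[of u "Max ?G" v "Max ?H"]
      mult_less_le_imp_less[of u "Max ?G" v "Max ?H"] by (auto simp: le_less)
  then have "a (Max ?G * Max ?H) = g (Max ?G) * h (Max ?H)"
    unfolding a_def using Gp Hp by (intro dirichlet_prod_unique_term) auto
  then have "Max ?G * Max ?H \<le> n"
    using Gb(2) Hb(2) range[of "Max ?G * Max ?H"] by simp
  then have maxs: "j' = Max ?G" "k' = Max ?H"
    using Gb(3)[OF j(2)] Hb(3)[OF k(2)] jk n mult_le_less_imp_less[of j' "Max ?G" k' "Max ?H"]
      mult_less_le_imp_less[of j' "Max ?G" k' "Max ?H"] by (auto simp: le_less)

  \<comment> \<open>Equal weights at \<open>j\<close> and \<open>j'\<close> mean that the face of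
    \<open>g\<close> is parallel to the segment.\<close>
  have "(val p (g j') - val p (g j)) * (ln (real n) - ln (real m))
      = D * (ln (real j') - ln (real j))"
    using j(3) by (simp add: weight_def L algebra_simps)
  then have "j = j' \<or> k = k'"
    using primitive_edge_indecomposable[of j k j' k' D "val p (g j') - val p (g j)"
        "prime_factors (m * n)"] jk \<open>m < n\<close> D gcd m n by auto
  then show ?thesis
  proof
    assume "j = j'"
    then have "g i \<noteq> 0 \<Longrightarrow> i = j" for i
      using Gb(3)[of i] mins maxs by simp
    then show ?thesis
      using prim dirichlet_const_if_singleton_support unfolding a_def by blast
  next
    assume "k = k'"
    then have "h i \<noteq> 0 \<Longrightarrow> i = k" for i
      using Hb(3)[of i] mins maxs by simp
    then show ?thesis
      using prim dirichlet_const_if_singleton_support[of h g]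
      unfolding a_def dirichlet_prod_commute[of g h] by blast
  qed
qed

section \<open>Clearing denominators\<close>

lemma common_denominator:
  fixes f :: "'b \<Rightarrow> 'a::idom fract"
  assumes "finite A"
  shows "\<exists>c. c \<noteq> 0 \<and> (\<forall>i\<in>A. \<exists>y. to_fract c * f i = to_fract y)"
  using assms
proof (induction A rule: finite_induct)
  case empty
  then show ?case
    by (auto intro: exI[of _ 1])
next
  case (insert x A)
  then obtain c where c: "c \<noteq> 0" "\<forall>i\<in>A. \<exists>y. to_fract c * f i = to_fract y"
    by blast
  obtain u v where uv: "f x = Fract u v" "v \<noteq> 0"
    by (cases "f x") auto
  have "to_fract (c * v) * f x = to_fract (c * u)"
    using uv by (simp add: Fract_conv_to_fract)
  moreover have "\<exists>y. to_fract (c * v) * f i = to_fract y" if i: "i \<in> A" for i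
  proof -
    obtain y where "to_fract c * f i = to_fract y"
      using c(2) i by blast
    then have "to_fract (c * v) * f i = to_fract (v * y)"
      by (simp add: mult_ac)
    then show ?thesis
      by blast
  qed
  ultimately show ?case
    using c uv by (intro exI[of _ "c * v"]) (auto simp del: to_fract_mult)
qed

text \<open>The support is kept, so that finiteness and nonconstancy carry over to
  \<open>g'\<close>.\<close>

lemma dirichlet_poly_clear_denominators:
  fixes g :: "nat \<Rightarrow> 'a::idom fract"
  assumes "dirichlet_poly g"
  obtains c g' where "c \<noteq> 0" "\<And>i. to_fract c * g i = to_fract (g' i)"
    "\<And>i. g' i = 0 \<longleftrightarrow> g i = 0"
proof -
  obtain c where c: "c \<noteq> 0" "\<forall>i\<in>{i. g i \<noteq> 0}. \<exists>y. to_fract c * g i = to_fract y"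
    using common_denominator[of "{i. g i \<noteq> 0}" g] assms by (auto simp: dirichlet_poly_def)
  have "\<exists>y. to_fract c * g i = to_fract y" for i
    using c(2) by (cases "g i = 0") (auto intro: exI[of _ 0])
  then obtain g' where g': "\<And>i. to_fract c * g i = to_fract (g' i)"
    by metis
  have "g' i = 0 \<longleftrightarrow> g i = 0" for i
    using g'[of i] c(1) by (metis mult_eq_0_iff to_fract_eq_0_iff)
  then show thesis
    using that c(1) g' by blast
qed

theorem theorem3p4:
  fixes a :: "nat \<Rightarrow> 'a::{factorial_semiring, idom}"
    and p :: 'a
    and m n :: nat
  assumes "dirichlet_poly a"
    and "\<forall>i. a i \<noteq> 0 \<longrightarrow> m \<le> i \<and> i \<le> n"
    and "a m \<noteq> 0" and "a n \<noteq> 0"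
    and "algebraically_primitive a"
    and "prime_elem p"
    and "val p (a n) \<noteq> val p (a m)"
    and "\<forall>i. m < i \<and> i < n \<and> a i \<noteq> 0 \<longrightarrow>
           (real n / real i) powi (val p (a i) - val p (a m))
             > (real m / real i) powi (val p (a i) - val p (a n))"
    and "Gcd (insert (val p (a n) - val p (a m))
                ((\<lambda>q. val q n - val q m) ` prime_factors (m * n))) = 1"
  shows "dirichlet_irreducible (\<lambda>i. to_fract (a i))"
  unfolding dirichlet_irreducible_def
proof (intro notI, elim exE conjE)
  fix g h :: "nat \<Rightarrow> 'a fract"
  assume g: "dirichlet_poly g" "\<not> dirichlet_const g"
    and h: "dirichlet_poly h" "\<not> dirichlet_const h"
    and eq: "(\<lambda>i. to_fract (a i)) = dirichlet_prod g h"
  obtain c g' where c: "c \<noteq> 0" "\<And>i. to_fract c * g i = to_fract (g' i)"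
    "\<And>i. g' i = 0 \<longleftrightarrow> g i = 0"
    by (rule dirichlet_poly_clear_denominators[OF g(1)]) blast
  obtain d h' where d: "d \<noteq> 0" "\<And>i. to_fract d * h i = to_fract (h' i)"
    "\<And>i. h' i = 0 \<longleftrightarrow> h i = 0"
    by (rule dirichlet_poly_clear_denominators[OF h(1)]) blast
  define b where "b = dirichlet_prod g' h'"
  have b: "b i = c * d * a i" for i
  proof -
    have "to_fract (b i) = to_fract c * to_fract d * dirichlet_prod g h i"
      by (auto simp: b_def dirichlet_prod_def sum_distrib_left mult_ac case_prod_unfold
          simp flip: c(2) d(2) intro!: sum.cong)
    also have "\<dots> = to_fract (c * d * a i)"
      by (simp flip: eq)
    finally show ?thesis
      by (simp only: to_fract_eq_iff)
  qed
  have b_nz: "b i \<noteq> 0 \<longleftrightarrow> a i \<noteq> 0" for i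
    using c(1) d(1) by (simp add: b)
  \<comment> \<open>The factor \<open>c * d\<close> shifts all valuations equally, so their
    differences agree for \<open>a\<close> and \<open>b\<close>.\<close>
  have val_b: "val p (b i) = val p (c * d) + val p (a i)" if "a i \<noteq> 0" for i
    using that c(1) d(1) assms(6) val_mult[of p "c * d" "a i"] by (simp add: b)
  have "m < n"
    using assms(2,3,7) by (metis le_neq_implies_less)
  have "0 < m"
    using assms(1,3) by (auto simp: dirichlet_poly_def intro: gr0I)
  let ?L = "ln (real n) - ln (real m)" and ?D = "val p (a n) - val p (a m)"
  have above: "weight ?L ?D p b m < weight ?L ?D p b i" if i: "m < i" "i < n" "a i \<noteq> 0" for i
  proof -
    have "(real m / real i) powi (val p (a i) - val p (a n))
        < (real n / real i) powi (val p (a i) - val p (a m))"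
      using assms(8) i by blast
    then have "ln ((real m / real i) powi (val p (a i) - val p (a n)))
        < ln ((real n / real i) powi (val p (a i) - val p (a m)))"
      using i \<open>0 < m\<close> \<open>m < n\<close> by (subst ln_less_cancel_iff) auto
    \<comment> \<open>In logarithms the terms \<open>val p (a i) * ln i\<close> on the two sides of
      (ii) cancel, and what remains compares the weights at \<open>m\<close> and
      \<open>i\<close>.\<close>
    then have "(val p (a i) - val p (a n)) * (ln (real m) - ln (real i))
        < (val p (a i) - val p (a m)) * (ln (real n) - ln (real i))"
      using i \<open>0 < m\<close> by (simp add: ln_div flip: powr_real_of_int')
    then show ?thesis
      using i assms(3) by (simp add: weight_def val_b algebra_simps)
  qed
  have "dirichlet_const g' \<or> dirichlet_const h'"
  proof (rule newton_edge_const_factor[where D = ?D and L = ?L and p = p and m = m and n = n],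
      unfold b_def[symmetric] b_nz)
    show "dirichlet_poly g'" "dirichlet_poly h'"
      using g(1) h(1) by (simp_all add: dirichlet_poly_def c(3) d(3))
    show "algebraically_primitive b"
      using assms(5) by (simp add: algebraically_primitive_def b_nz del: mult_eq_0_iff)
    show "val p (a n) - val p (a m) = val p (b n) - val p (b m)"
      using assms(3,4) by (simp add: val_b)
  qed (use assms above \<open>m < n\<close> in auto)
  then show False
    using g(2) h(2) by (simp add: dirichlet_const_def c(3) d(3))
qed

end
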